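(* Let $X = X_1\times\cdots\times X_N\subset\mathbb{R}^n$ with each $X_i \subset \mathbb{R}^{n_i}$ non-empty, compact and convex; let $f(x) = c(x)+\sum_{i=1}^N f_i(x_i)$ with each $f_i$ convex and $C^2$ and $c$ convex and $C^2$; let $g=(g_1,\dots,g_m):\mathbb{R}^n\to\mathbb{R}^m$ be convex (componentwise) and $C^2$; and suppose there is $\bar{x}\in X$ with $g(\bar{x})<0$ componentwise. Let $\hat{x}$ be (the primal component of) a solution of minimizing $f(x)$ subject to $g(x)\le 0$, $x\in X$, and for $\alpha,\beta>0$ let $(\hat{x}_{\alpha,\beta},\hat\mu_{\alpha,\beta})$ be the unique saddle point of the regularized Lagrangian $L_{\alpha,\beta}$ over $X\times\mathbb{R}^m_+$. Let $\epsilon>0$ be given and set $$\hat{M} = \max\Big\{\max_{1\le j\le m} M_{g_j}M_\mu,\; M_f M_\mu\Big\}.$$ Then choosing regularization parameters $\alpha>0$ with $\alpha < 2\epsilon/(\hat{M}+M_x^2)$ and $\beta=\alpha^3/2$ gives $$\max\{0,g_j(\hat{x}_{\alpha,\beta})\}<\epsilon \ \text{ for all } j\in\{1,\dots,m\}, \qquad\text{and}\qquad |f(\hat{x}_{\alpha,\beta})-f(\hat{x})|<\epsilon .$$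
   Context: $\|\cdot\|$ is the Euclidean norm and $\mathbb{R}^m_+$ is the non-negative orthant. The regularized Lagrangian with parameters $\alpha,\beta>0$ is $$L_{\alpha,\beta}(x,\mu)=f(x)+\tfrac{\alpha}{2}\|x\|^2+\mu^Tg(x)-\tfrac{\beta}{2}\|\mu\|^2,$$ which is minimized over $x\in X$ and maximized over $\mu\in\mathbb{R}^m_+$; under the stated hypotheses it has a unique saddle point. With $f^*:=\min_{x\in X}f(x)$ and $\bar{x}$ the fixed Slater point, define the compact dual set $$M=\Big\{\mu\in\mathbb{R}^m_+ : \|\mu\|_1\le \frac{f(\bar{x})+\frac{\alpha}{2}\|\bar{x}\|^2-f^*}{\min_{1\le j\le m}\{-g_j(\bar{x})\}}\Big\},$$ where $\alpha$ is the regularization parameter in use. The constants are $M_f:=\max_{x\in X}\|\nabla f(x)\|$, $M_\mu:=\max_{\mu\in M}\|\mu\|$, $M_{g_j}:=\max_{x\in X}\|\nabla g_j(x)\|$, $M_x:=\max_{x\in X}\|x\|$. *)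

theory Defs
  imports "HOL-Analysis.Analysis"
begin

text \<open>
  Block structure on real vectors: a map \<open>b\<close> assigns every coordinate to one of finitely many
  blocks, so the blocks may have different sizes. The factor space of block \<open>i\<close> is identified
  with the subspace \<open>block_space b i\<close> of vectors vanishing outside that block (same norm and
  topology), and the block component \<open>x\<^sub>i\<close> is \<open>block b i x\<close>. A function on the factor space is
  twice continuously differentiable iff its composition with the linear surjection
  \<open>block b i\<close> is.
\<close>

definition block :: "('n \<Rightarrow> 'i) \<Rightarrow> 'i \<Rightarrow> real ^ 'n \<Rightarrow> real ^ 'n" where
  "block b i x = (\<chi> k. if b k = i then x $ k else 0)"

definition block_space :: "('n \<Rightarrow> 'i) \<Rightarrow> 'i \<Rightarrow> (real ^ 'n) set" where
  "block_space b i = {x. \<forall>k. b k \<noteq> i \<longrightarrow> x $ k = 0}"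

definition block_product :: "('n \<Rightarrow> 'i) \<Rightarrow> ('i \<Rightarrow> (real ^ 'n) set) \<Rightarrow> (real ^ 'n) set" where
  "block_product b Xs = {x. \<forall>i. block b i x \<in> Xs i}"

definition C2 :: "('a::euclidean_space \<Rightarrow> real) \<Rightarrow> bool" where
  "C2 f \<longleftrightarrow> (\<exists>(G :: 'a \<Rightarrow> 'a) (H :: 'a \<Rightarrow> 'a \<Rightarrow>\<^sub>L 'a).
     (\<forall>x. GDERIV f x :> G x) \<and>
     (\<forall>x. (G has_derivative blinfun_apply (H x)) (at x)) \<and>
     continuous_on UNIV H)"

definition grad :: "('a::euclidean_space \<Rightarrow> real) \<Rightarrow> 'a \<Rightarrow> 'a" where
  "grad f x = (THE D. GDERIV f x :> D)"

definition nonneg_orthant :: "(real ^ 'm) set" where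
  "nonneg_orthant = {\<mu>. \<forall>j. 0 \<le> \<mu> $ j}"

definition reg_lagrangian ::
  "real \<Rightarrow> real \<Rightarrow> (real ^ 'n \<Rightarrow> real) \<Rightarrow> (real ^ 'n \<Rightarrow> real ^ 'm) \<Rightarrow> real ^ 'n \<Rightarrow> real ^ 'm \<Rightarrow> real" where
  "reg_lagrangian \<alpha> \<beta> f g x \<mu> =
     f x + \<alpha> / 2 * (norm x)\<^sup>2 + \<mu> \<bullet> g x - \<beta> / 2 * (norm \<mu>)\<^sup>2"

definition saddle_point :: "('a \<Rightarrow> 'b \<Rightarrow> real) \<Rightarrow> 'a set \<Rightarrow> 'b set \<Rightarrow> 'a \<Rightarrow> 'b \<Rightarrow> bool" where
  "saddle_point L X Y x y \<longleftrightarrow> x \<in> X \<and> y \<in> Y \<and>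
     (\<forall>x'\<in>X. \<forall>y'\<in>Y. L x y' \<le> L x y \<and> L x y \<le> L x' y)"

text \<open>
  Maxima and minima over infinite (compact) sets are written as \<open>SUP\<close> and \<open>INF\<close>; for
  continuous functions on nonempty compact sets these are attained.
\<close>

definition dual_set ::
  "real \<Rightarrow> (real ^ 'n) set \<Rightarrow> (real ^ 'n \<Rightarrow> real) \<Rightarrow> (real ^ 'n \<Rightarrow> real ^ 'm) \<Rightarrow> real ^ 'n
     \<Rightarrow> (real ^ 'm) set" where
  "dual_set \<alpha> X f g xbar = {\<mu> \<in> nonneg_orthant.
     (\<Sum>j\<in>UNIV. \<bar>\<mu> $ j\<bar>) \<le>
       (f xbar + \<alpha> / 2 * (norm xbar)\<^sup>2 - (INF x\<in>X. f x)) / (MIN j. - (g xbar $ j))}"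

definition max_norm :: "'a::real_normed_vector set \<Rightarrow> real" where
  "max_norm S = (SUP x\<in>S. norm x)"

definition max_grad_norm :: "'a::euclidean_space set \<Rightarrow> ('a \<Rightarrow> real) \<Rightarrow> real" where
  "max_grad_norm S h = (SUP x\<in>S. norm (grad h x))"

end

theory Submission
  imports Defs
begin

text \<open>
  Regularizing only the primal variable perturbs the optimal value in a controlled way: if \<open>y\<close>
  minimizes \<open>h x = f x + \<alpha>/2 * \<parallel>x\<parallel>\<^sup>2\<close> over the feasible set, then \<open>y\<close> is feasible and
  \<open>f y\<close> exceeds \<open>f xhat\<close> by at most \<open>\<alpha>/2 * Mx\<^sup>2\<close>. So it suffices to show that the saddle point
  component \<open>xhat_reg\<close>, which is affected by the dual regularization as well and may be infeasible,
  lies close to \<open>y\<close>, and to transfer this to \<open>f\<close> and each \<open>g\<^sub>j\<close> by their Lipschitz constants on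
  the compact convex set \<open>X\<close>, the maximal gradient norms (\<open>lipschitz_max_grad_norm\<close>).

  By Slater's condition \<open>y\<close> has a Lagrange multiplier \<open>\<kappa>\<close> (\<open>slater_lagrange_multiplier\<close>), and
  comparing the Lagrangian at \<open>y\<close> and at the Slater point puts \<open>\<kappa>\<close> into the dual set
  (\<open>multiplier_l1_bound\<close>), so \<open>\<parallel>\<kappa>\<parallel> \<le> M\<mu>\<close>. The pair \<open>(y, \<kappa>)\<close> is a saddle point of the Lagrangian
  with \<open>\<beta> = 0\<close>. Three strong convexity inequalities (for \<open>y\<close>, for \<open>xhat_reg\<close>, and for the dual
  component in its own concave maximization) combine to
  \<open>\<alpha> * \<parallel>xhat_reg - y\<parallel>\<^sup>2 \<le> \<beta>/4 * \<parallel>\<kappa>\<parallel>\<^sup>2\<close> (\<open>regularized_saddle_distance\<close>). The coupling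
  \<open>\<beta> = \<alpha>\<^sup>3/2\<close> makes the distance at most \<open>\<alpha>/2 * M\<mu>\<close>. Hence the constraint violation is at most
  \<open>\<alpha>/2 * Mhat\<close>, the objective error at most \<open>\<alpha>/2 * (Mhat + Mx\<^sup>2)\<close>, and the bound on \<open>\<alpha>\<close> makes
  both smaller than \<open>\<epsilon>\<close>.
\<close>

section \<open>Minimizers of quadratically regularized convex functions\<close>

lemma norm_convex_combination_sq:
  fixes x z :: "'a::real_inner"
  shows "(norm ((1 - t) *\<^sub>R x + t *\<^sub>R z))\<^sup>2
    = (1 - t) * (norm x)\<^sup>2 + t * (norm z)\<^sup>2 - t * (1 - t) * (norm (z - x))\<^sup>2"
  by (simp add: power2_norm_eq_inner inner_add_left inner_add_right inner_diff_left
      inner_diff_right inner_commute algebra_simps)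

lemma convex_on_norm_sq:
  fixes S :: "'a::real_inner set"
  assumes "convex S"
  shows "convex_on S (\<lambda>x. (norm x)\<^sup>2)"
  using assms by (intro convex_onI) (auto simp: norm_convex_combination_sq)

text \<open>
  For \<open>k > 0\<close> the quadratic term makes the objective strongly convex, so it grows quadratically away from its
  minimizer. The growth is read off from the values on the segment towards \<open>z\<close>: minimality at a
  point with parameter \<open>t\<close> gives the claim with the last term scaled by \<open>1 - t\<close>, and \<open>t\<close> tends
  to \<open>0\<close>.
\<close>

lemma regularized_minimizer_quadratic_growth:
  fixes \<phi> :: "'a::real_inner \<Rightarrow> real"
  assumes S: "convex S" and \<phi>: "convex_on S \<phi>" and x: "x \<in> S" and z: "z \<in> S"
    and min: "\<And>w. w \<in> S \<Longrightarrow> \<phi> x + k / 2 * (norm x)\<^sup>2 \<le> \<phi> w + k / 2 * (norm w)\<^sup>2"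
  shows "\<phi> x + k / 2 * (norm x)\<^sup>2 + k / 2 * (norm (z - x))\<^sup>2 \<le> \<phi> z + k / 2 * (norm z)\<^sup>2"
proof -
  define A where "A = \<phi> x + k / 2 * (norm x)\<^sup>2"
  define B where "B = k / 2 * (norm (z - x))\<^sup>2"
  define C where "C = \<phi> z + k / 2 * (norm z)\<^sup>2"
  have step: "A + (1 - t) * B \<le> C" if t: "0 < t" "t < 1" for t
  proof -
    let ?w = "(1 - t) *\<^sub>R x + t *\<^sub>R z"
    have "?w \<in> S"
      using S x z t by (simp add: convex_alt)
    then have "A \<le> \<phi> ?w + k / 2 * (norm ?w)\<^sup>2"
      using min unfolding A_def by blast
    also have "\<dots> \<le> (1 - t) * \<phi> x + t * \<phi> z + k / 2 * (norm ?w)\<^sup>2"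
      using convex_onD[OF \<phi>, of t x z] x z t by simp
    also have "\<dots> = (1 - t) * A + t * C - t * ((1 - t) * B)"
      unfolding norm_convex_combination_sq A_def B_def C_def by (simp add: field_simps)
    finally have "t * (A + (1 - t) * B) \<le> t * C"
      by (simp add: algebra_simps)
    then show ?thesis
      using t by simp
  qed
  have "((\<lambda>t. A + (1 - t) * B) \<longlongrightarrow> A + (1 - 0) * B) (at_right 0)"
    by (intro tendsto_intros)
  moreover have "\<forall>\<^sub>F t in at_right 0. A + (1 - t) * B \<le> C"
    using step by (auto simp: eventually_at_right_field intro!: exI[of _ 1])
  ultimately have "A + (1 - 0) * B \<le> C"
    by (rule tendsto_upperbound) simp
  then show ?thesis
    by (simp add: A_def B_def C_def)
qed

section \<open>Lagrange multipliers\<close>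

lemma convex_on_sum_functions:
  assumes "convex S" "\<And>i. i \<in> I \<Longrightarrow> convex_on S (f i)"
  shows "convex_on S (\<lambda>x. \<Sum>i\<in>I. f i x)"
  using assms(2)
  by (induction I rule: infinite_finite_induct) (auto simp: convex_on_const assms(1))

lemma convex_on_inner_nonneg:
  fixes g :: "'a::real_vector \<Rightarrow> real ^ 'm::finite"
  assumes "convex S" "\<And>j. convex_on S (\<lambda>x. g x $ j)" "\<And>j. 0 \<le> \<mu> $ j"
  shows "convex_on S (\<lambda>x. \<mu> \<bullet> g x)"
  unfolding inner_vec_def inner_real_def
  using assms by (intro convex_on_sum_functions convex_on_cmul) auto

text \<open>
  Strong duality with an attained multiplier. The set of all pairs \<open>(u, t)\<close> that dominate some
  \<open>(g z, h z - p)\<close>, strictly in the last coordinate, is convex and misses the origin because \<open>p\<close> is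
  a lower bound on the feasible points. A hyperplane separates it from the origin; the Slater point
  ensures that this hyperplane is not vertical, that is, the coefficient \<open>s\<close> of the objective is
  positive, and dividing by \<open>s\<close> gives the multiplier.
\<close>

lemma slater_lagrange_multiplier:
  fixes h :: "'a::real_vector \<Rightarrow> real" and g :: "'a \<Rightarrow> real ^ 'm::finite"
  assumes S: "convex S" and h: "convex_on S h" and g: "\<And>j. convex_on S (\<lambda>x. g x $ j)"
    and slater: "xbar \<in> S" "\<And>j. g xbar $ j < 0"
    and lower: "\<And>z. z \<in> S \<Longrightarrow> \<forall>j. g z $ j \<le> 0 \<Longrightarrow> p \<le> h z"
  obtains \<kappa> where "\<kappa> \<in> nonneg_orthant" "\<And>z. z \<in> S \<Longrightarrow> p \<le> h z + \<kappa> \<bullet> g z"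
proof -
  define T :: "((real ^ 'm) \<times> real) set"
    where "T = {(u, t). \<exists>z\<in>S. (\<forall>j. g z $ j \<le> u $ j) \<and> h z - p < t}"
  have memT: "(u, t) \<in> T" if "z \<in> S" "\<And>j. g z $ j \<le> u $ j" "h z - p < t" for z u t
    using that unfolding T_def by blast
  have "convex T"
    unfolding convex_alt
  proof (intro ballI allI impI)
    fix q r and a :: real
    assume "q \<in> T" "r \<in> T" and a: "0 \<le> a \<and> a \<le> 1"
    then obtain u s z v t w where q: "q = (u, s)" "z \<in> S" "\<And>j. g z $ j \<le> u $ j" "h z - p < s"
      and r: "r = (v, t)" "w \<in> S" "\<And>j. g w $ j \<le> v $ j" "h w - p < t"
      unfolding T_def by blast
    let ?x = "(1 - a) *\<^sub>R z + a *\<^sub>R w"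
    have "((1 - a) *\<^sub>R u + a *\<^sub>R v, (1 - a) * s + a * t) \<in> T"
    proof (rule memT)
      show "?x \<in> S"
        using S q r a by (simp add: convex_alt)
      show "g ?x $ j \<le> ((1 - a) *\<^sub>R u + a *\<^sub>R v) $ j" for j
      proof -
        have "g ?x $ j \<le> (1 - a) * g z $ j + a * g w $ j"
          using convex_onD[OF g[of j], of a z w] q r a by simp
        also have "\<dots> \<le> (1 - a) * u $ j + a * v $ j"
          using q(3)[of j] r(3)[of j] a by (intro add_mono mult_left_mono) auto
        finally show ?thesis by simp
      qed
      have "h ?x \<le> (1 - a) * h z + a * h w"
        using convex_onD[OF h, of a z w] q r a by simp
      then have "h ?x - p \<le> (1 - a) * (h z - p) + a * (h w - p)"
        by (simp add: algebra_simps)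
      also have "\<dots> < (1 - a) * s + a * t"
      proof (cases "a = 0")
        case False
        then have "a * (h w - p) < a * t" "(1 - a) * (h z - p) \<le> (1 - a) * s"
          using a q(4) r(4) by (auto intro: mult_left_mono)
        then show ?thesis by simp
      qed (use q in simp)
      finally show "h ?x - p < (1 - a) * s + a * t" .
    qed
    then show "(1 - a) *\<^sub>R q + a *\<^sub>R r \<in> T"
      by (simp add: q r)
  qed
  moreover have "0 \<notin> T"
    using lower by (force simp: T_def zero_prod_def)
  ultimately obtain ls where ls: "ls \<noteq> 0" "\<And>q. q \<in> T \<Longrightarrow> 0 \<le> ls \<bullet> q"
    using separating_hyperplane_set_0 by metis
  obtain l s where [simp]: "ls = (l, s)"
    by fastforce
  have sep: "0 \<le> l \<bullet> u + s * t" if "(u, t) \<in> T" for u t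
    using ls(2)[OF that] by simp
  \<comment> \<open>The set \<open>T\<close> is closed under increasing any coordinate. A negative coefficient of the
    separating functional would be exposed by moving far enough in that coordinate, starting from
    the Slater point; \<open>t\<close> below and \<open>a\<close> in the next step are chosen large enough for this.\<close>
  have s: "0 \<le> s"
  proof (rule ccontr)
    assume "\<not> 0 \<le> s"
    define t where "t = max (h xbar - p + 1) ((l \<bullet> g xbar + 1) / (- s))"
    have "(g xbar, t) \<in> T"
      by (rule memT[of xbar]) (auto simp: t_def slater)
    from sep[OF this] have "- s * t \<le> l \<bullet> g xbar"
      by simp
    moreover have "- s * ((l \<bullet> g xbar + 1) / (- s)) \<le> - s * t"
      using \<open>\<not> 0 \<le> s\<close> by (intro mult_left_mono) (auto simp: t_def)
    ultimately show False
      using \<open>\<not> 0 \<le> s\<close> by simp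
  qed
  have l: "0 \<le> l $ j" for j
  proof (rule ccontr)
    assume neg: "\<not> 0 \<le> l $ j"
    define t where "t = h xbar - p + 1"
    define a where "a = (\<bar>l \<bullet> g xbar + s * t\<bar> + 1) / (- (l $ j))"
    have a: "0 \<le> a" and la: "l $ j * a = - (\<bar>l \<bullet> g xbar + s * t\<bar> + 1)"
      using neg by (auto simp: a_def field_simps)
    have "(g xbar + a *\<^sub>R axis j 1, t) \<in> T"
      by (rule memT[of xbar]) (auto simp: t_def slater axis_def a)
    from sep[OF this] show False
      using la by (simp add: inner_add_right inner_axis mult.commute algebra_simps)
  qed
  \<comment> \<open>The points \<open>(g z, h z - p)\<close> need not lie in \<open>T\<close>, but they are limits of points of \<open>T\<close>.\<close>
  have sep': "0 \<le> l \<bullet> g z + s * (h z - p)" if z: "z \<in> S" for z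
  proof (rule field_le_epsilon)
    fix e :: real assume e: "0 < e"
    have "(g z, h z - p + e / (s + 1)) \<in> T"
      using z e s by (intro memT[of z]) auto
    from sep[OF this] have "0 \<le> l \<bullet> g z + s * (h z - p) + s * (e / (s + 1))"
      by (simp add: algebra_simps)
    also have "s * (e / (s + 1)) \<le> e"
      using e s by (simp add: field_simps)
    finally show "0 \<le> l \<bullet> g z + s * (h z - p) + e"
      by simp
  qed
  have "s \<noteq> 0"
  proof
    assume "s = 0"
    then have "0 \<le> l \<bullet> g xbar"
      using sep'[of xbar] slater by simp
    moreover obtain j where "l $ j \<noteq> 0"
      using ls(1) \<open>s = 0\<close> by (auto simp: vec_eq_iff zero_prod_def)
    have "(\<Sum>i\<in>UNIV. l $ i * g xbar $ i) < (\<Sum>i\<in>(UNIV::'m set). 0)"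
    proof (rule sum_strict_mono_ex1)
      show "\<forall>i\<in>UNIV. l $ i * g xbar $ i \<le> 0"
        using l slater(2) by (simp add: mult_nonneg_nonpos less_imp_le)
      show "\<exists>i\<in>UNIV. l $ i * g xbar $ i < 0"
        using l[of j] \<open>l $ j \<noteq> 0\<close> slater(2)[of j]
        by (intro bexI[of _ j]) (auto intro!: mult_pos_neg)
    qed simp
    ultimately show False
      by (simp add: inner_vec_def)
  qed
  with s have s: "0 < s" by simp
  show thesis
  proof (rule that[of "(1 / s) *\<^sub>R l"])
    show "(1 / s) *\<^sub>R l \<in> nonneg_orthant"
      using l s by (simp add: nonneg_orthant_def)
    show "p \<le> h z + (1 / s) *\<^sub>R l \<bullet> g z" if "z \<in> S" for z
      using sep'[OF that] s by (simp add: field_simps)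
  qed
qed

text \<open>
  The value \<open>v\<close> of the constraints at a Slater point is uniformly negative, so a multiplier with
  large total mass would push the Lagrangian value \<open>q + \<kappa> \<bullet> v\<close> at that point below the
  lower bound \<open>p\<close>.
\<close>

lemma multiplier_l1_bound:
  fixes \<kappa> v :: "real ^ 'm::finite"
  assumes \<kappa>: "\<kappa> \<in> nonneg_orthant" and v: "\<And>j. v $ j < 0" and bound: "p \<le> q + \<kappa> \<bullet> v"
  shows "(\<Sum>j\<in>UNIV. \<bar>\<kappa> $ j\<bar>) \<le> (q - p) / (MIN j. - (v $ j))"
proof -
  let ?d = "MIN j. - (v $ j)"
  have d: "0 < ?d"
    using v by simp
  have "(\<Sum>j\<in>UNIV. \<bar>\<kappa> $ j\<bar>) * ?d = (\<Sum>j\<in>UNIV. \<kappa> $ j * ?d)"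
    using \<kappa> by (simp add: nonneg_orthant_def sum_distrib_right)
  also have "\<dots> \<le> (\<Sum>j\<in>UNIV. \<kappa> $ j * - (v $ j))"
    using \<kappa> by (intro sum_mono mult_left_mono) (auto simp: nonneg_orthant_def)
  also have "\<dots> = - (\<kappa> \<bullet> v)"
    by (simp add: inner_vec_def sum_negf)
  also have "\<dots> \<le> q - p"
    using bound by simp
  finally show ?thesis
    using d by (simp add: pos_le_divide_eq)
qed

lemma bounded_dual_set: "bounded (dual_set \<alpha> X f g xbar)"
  unfolding bounded_iff dual_set_def
  by (intro exI ballI) (auto intro: order_trans[OF norm_le_l1_cart])

section \<open>Effect of the dual regularization\<close>

lemma convex_nonneg_orthant: "convex nonneg_orthant"
  by (simp add: nonneg_orthant_def convex_alt)

text \<open>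
  The points \<open>x\<close> and \<open>y\<close> minimize the Lagrangians of \<open>f + \<alpha>/2 * \<parallel>\<cdot>\<parallel>\<^sup>2\<close> with multipliers \<open>\<mu>\<close> and \<open>\<kappa>\<close>.
  Adding their growth inequalities bounds \<open>\<alpha> * \<parallel>x - y\<parallel>\<^sup>2\<close> by the differences of the multiplier
  terms; feasibility of \<open>y\<close> and complementary slackness leave only \<open>(\<kappa> - \<mu>) \<bullet> g x\<close>. Since
  \<open>\<mu>\<close> minimizes \<open>\<beta>/2 * \<parallel>\<nu>\<parallel>\<^sup>2 - \<nu> \<bullet> g x\<close> over \<open>\<nu>\<close> in the orthant, the same growth inequality
  bounds this by \<open>\<beta> * (\<mu> \<bullet> (\<kappa> - \<mu>))\<close>, which is largest at \<open>\<mu> = \<kappa>/2\<close>.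
\<close>

lemma regularized_saddle_distance:
  fixes f :: "real ^ 'n::finite \<Rightarrow> real" and g :: "real ^ 'n \<Rightarrow> real ^ 'm::finite"
  assumes X: "convex X" and f: "convex_on X f" and g: "\<And>j. convex_on X (\<lambda>x. g x $ j)"
    and saddle: "saddle_point (reg_lagrangian \<alpha> \<beta> f g) X nonneg_orthant x \<mu>"
    and "0 \<le> \<beta>"
    and y: "y \<in> X" "\<And>j. g y $ j \<le> 0"
    and \<kappa>: "\<kappa> \<in> nonneg_orthant"
    and dual: "\<And>z. z \<in> X \<Longrightarrow> f y + \<alpha> / 2 * (norm y)\<^sup>2 \<le> f z + \<alpha> / 2 * (norm z)\<^sup>2 + \<kappa> \<bullet> g z"
  shows "\<alpha> * (norm (x - y))\<^sup>2 \<le> \<beta> / 4 * (norm \<kappa>)\<^sup>2"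
proof -
  have nonpos: "\<nu> \<bullet> g y \<le> 0" if "\<nu> \<in> nonneg_orthant" for \<nu>
    using that y(2) unfolding inner_vec_def inner_real_def nonneg_orthant_def
    by (intro sum_nonpos mult_nonneg_nonpos) auto
  have x: "x \<in> X" and \<mu>: "\<mu> \<in> nonneg_orthant"
    and le_x: "\<And>\<nu>. \<nu> \<in> nonneg_orthant \<Longrightarrow>
      reg_lagrangian \<alpha> \<beta> f g x \<nu> \<le> reg_lagrangian \<alpha> \<beta> f g x \<mu>"
    and le_\<mu>: "\<And>z. z \<in> X \<Longrightarrow> reg_lagrangian \<alpha> \<beta> f g x \<mu> \<le> reg_lagrangian \<alpha> \<beta> f g z \<mu>"
    using saddle unfolding saddle_point_def by blast+
  have convex_lagrangian: "convex_on X (\<lambda>z. f z + \<nu> \<bullet> g z)" if "\<nu> \<in> nonneg_orthant" for \<nu>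
    using that by (intro convex_on_add f convex_on_inner_nonneg X g) (auto simp: nonneg_orthant_def)
  have slack: "\<kappa> \<bullet> g y = 0"
    using dual[OF y(1)] nonpos[OF \<kappa>] by simp
  have A: "f x + \<mu> \<bullet> g x + \<alpha> / 2 * (norm x)\<^sup>2 + \<alpha> / 2 * (norm (y - x))\<^sup>2
      \<le> f y + \<mu> \<bullet> g y + \<alpha> / 2 * (norm y)\<^sup>2"
    using le_\<mu> by (intro regularized_minimizer_quadratic_growth[OF X convex_lagrangian[OF \<mu>] x y(1)])
      (auto simp: reg_lagrangian_def algebra_simps)
  have B: "f y + \<kappa> \<bullet> g y + \<alpha> / 2 * (norm y)\<^sup>2 + \<alpha> / 2 * (norm (x - y))\<^sup>2
      \<le> f x + \<kappa> \<bullet> g x + \<alpha> / 2 * (norm x)\<^sup>2"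
    using dual slack
    by (intro regularized_minimizer_quadratic_growth[OF X convex_lagrangian[OF \<kappa>] y(1) x])
      (auto simp: algebra_simps)
  have lin: "convex_on nonneg_orthant (\<lambda>\<nu>. - (\<nu> \<bullet> g x))"
    by (intro convex_onI convex_nonneg_orthant) (simp add: inner_add_left)
  have C: "- (\<mu> \<bullet> g x) + \<beta> / 2 * (norm \<mu>)\<^sup>2 + \<beta> / 2 * (norm (\<kappa> - \<mu>))\<^sup>2
      \<le> - (\<kappa> \<bullet> g x) + \<beta> / 2 * (norm \<kappa>)\<^sup>2"
  proof (rule regularized_minimizer_quadratic_growth[OF convex_nonneg_orthant lin \<mu> \<kappa>])
    show "- (\<mu> \<bullet> g x) + \<beta> / 2 * (norm \<mu>)\<^sup>2 \<le> - (\<nu> \<bullet> g x) + \<beta> / 2 * (norm \<nu>)\<^sup>2"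
      if "\<nu> \<in> nonneg_orthant" for \<nu>
      using le_x[OF that] unfolding reg_lagrangian_def by linarith
  qed
  have "\<alpha> * (norm (x - y))\<^sup>2 \<le> \<mu> \<bullet> g y + (\<kappa> \<bullet> g x - \<mu> \<bullet> g x)"
    using A B slack by (simp add: norm_minus_commute[of y x])
  also have "\<dots> \<le> \<kappa> \<bullet> g x - \<mu> \<bullet> g x"
    using nonpos[OF \<mu>] by simp
  also have "\<dots> \<le> \<beta> / 2 * ((norm \<kappa>)\<^sup>2 - (norm \<mu>)\<^sup>2 - (norm (\<kappa> - \<mu>))\<^sup>2)"
    using C by (simp add: algebra_simps)
  \<comment> \<open>Completing the square in \<open>\<mu>\<close>.\<close>
  also have "\<dots> = \<beta> / 2 * ((norm \<kappa>)\<^sup>2 / 2 - 2 * (norm (\<mu> - (1 / 2) *\<^sub>R \<kappa>))\<^sup>2)"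
    by (simp add: power2_norm_eq_inner inner_diff_left inner_diff_right inner_commute algebra_simps)
  also have "\<dots> \<le> \<beta> / 2 * ((norm \<kappa>)\<^sup>2 / 2)"
    using \<open>0 \<le> \<beta>\<close> by (intro mult_left_mono) auto
  finally show ?thesis
    by simp
qed

section \<open>Gradients and Lipschitz bounds\<close>

lemma C2_add: "C2 (\<lambda>x. p x + q x)" if p: "C2 p" and q: "C2 q"
proof -
  obtain G H where p: "\<And>x. GDERIV p x :> G x"
      "\<And>x. (G has_derivative blinfun_apply (H x)) (at x)" "continuous_on UNIV H"
    using p unfolding C2_def by blast
  obtain G' H' where q: "\<And>x. GDERIV q x :> G' x"
      "\<And>x. (G' has_derivative blinfun_apply (H' x)) (at x)" "continuous_on UNIV H'"
    using q unfolding C2_def by blast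
  have "((\<lambda>x. G x + G' x) has_derivative blinfun_apply (H x + H' x)) (at x)" for x
    using has_derivative_add[OF p(2) q(2)] by (simp add: plus_blinfun.rep_eq)
  then show ?thesis
    unfolding C2_def using p q
    by (intro exI[of _ "\<lambda>x. G x + G' x"] exI[of _ "\<lambda>x. H x + H' x"] conjI allI
        GDERIV_add continuous_on_add)
qed

lemma C2_zero: "C2 (\<lambda>x. 0)"
  unfolding C2_def
  by (intro exI[of _ "\<lambda>_. 0"] conjI allI)
    (simp_all add: GDERIV_const zero_blinfun.rep_eq)

lemma C2_sum: "C2 (\<lambda>x. \<Sum>i\<in>I. p i x)" if "\<And>i. i \<in> I \<Longrightarrow> C2 (p i)"
  using that by (induction I rule: infinite_finite_induct) (auto intro: C2_add C2_zero)

lemma GDERIV_imp_grad_eq: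
  assumes "GDERIV h x :> G"
  shows "grad h x = G"
  unfolding grad_def
proof (rule the_equality, rule assms)
  fix D assume "GDERIV h x :> D"
  then have "(\<lambda>v. v \<bullet> D) = (\<lambda>v. v \<bullet> G)"
    using assms has_derivative_unique unfolding gderiv_def by blast
  then show "D = G"
    by (metis vector_eq_ldot)
qed

lemma C2_GDERIV_grad: "GDERIV h x :> grad h x" if h: "C2 h"
proof -
  obtain G where "GDERIV h x :> G"
    using h unfolding C2_def by blast
  then show ?thesis
    using GDERIV_imp_grad_eq by metis
qed

lemma C2_continuous_grad: "continuous_on UNIV (grad h)" if h: "C2 h"
proof -
  obtain G H where G: "\<And>x. GDERIV h x :> G x" "\<And>x. (G has_derivative blinfun_apply (H x)) (at x)"
    using h unfolding C2_def by blast
  have "grad h = G"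
    using GDERIV_imp_grad_eq[OF G(1)] by auto
  moreover have "continuous_on UNIV G"
    by (intro continuous_at_imp_continuous_on ballI has_derivative_continuous[OF G(2)])
  ultimately show ?thesis
    by simp
qed

lemma C2_continuous: "continuous_on S h" if "C2 h"
  using C2_GDERIV_grad[OF that] unfolding gderiv_def
  by (auto intro: continuous_at_imp_continuous_on has_derivative_continuous)

lemma norm_le_max_norm:
  assumes "bounded S" "x \<in> S"
  shows "norm x \<le> max_norm S"
  unfolding max_norm_def using assms
  by (intro cSUP_upper) (auto simp: bounded_iff bdd_above_def)

lemma norm_grad_le_max_grad_norm:
  fixes h :: "'a::euclidean_space \<Rightarrow> real"
  assumes S: "compact S" and h: "C2 h" and x: "x \<in> S"
  shows "norm (grad h x) \<le> max_grad_norm S h"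
proof -
  have "compact ((\<lambda>z. norm (grad h z)) ` S)"
    using C2_continuous_grad[OF h] S
    by (intro compact_continuous_image continuous_on_norm) (auto intro: continuous_on_subset)
  then have "bdd_above ((\<lambda>z. norm (grad h z)) ` S)"
    by (simp add: bounded_imp_bdd_above compact_imp_bounded)
  then show ?thesis
    unfolding max_grad_norm_def using x by (rule cSUP_upper2) simp
qed

lemma max_grad_norm_nonneg:
  fixes h :: "'a::euclidean_space \<Rightarrow> real"
  assumes "compact S" "C2 h" "x \<in> S"
  shows "0 \<le> max_grad_norm S h"
  using norm_grad_le_max_grad_norm[OF assms] norm_ge_zero[of "grad h x"] by linarith

lemma lipschitz_max_grad_norm:
  fixes h :: "'a::euclidean_space \<Rightarrow> real"
  assumes S: "compact S" "convex S" and h: "C2 h" and xy: "x \<in> S" "y \<in> S"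
  shows "\<bar>h x - h y\<bar> \<le> max_grad_norm S h * norm (x - y)"
proof -
  have "norm (h x - h y) \<le> max_grad_norm S h * norm (x - y)"
  proof (rule differentiable_bound[OF S(2)])
    fix z assume z: "z \<in> S"
    show "(h has_derivative (\<lambda>v. v \<bullet> grad h z)) (at z within S)"
      using C2_GDERIV_grad[OF h, of z] unfolding gderiv_def
      by (rule has_derivative_at_withinI)
    show "onorm (\<lambda>v. v \<bullet> grad h z) \<le> max_grad_norm S h"
    proof (rule onorm_bound)
      have le: "norm (grad h z) \<le> max_grad_norm S h"
        by (rule norm_grad_le_max_grad_norm[OF S(1) h z])
      show "0 \<le> max_grad_norm S h"
        by (rule max_grad_norm_nonneg[OF S(1) h z])
      show "norm (v \<bullet> grad h z) \<le> max_grad_norm S h * norm v" for v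
        using Cauchy_Schwarz_ineq2[of v "grad h z"] mult_right_mono[OF le norm_ge_zero[of v]]
        by (simp add: mult.commute)
    qed
  qed (use xy in auto)
  then show ?thesis
    by simp
qed

section \<open>Products of blocks\<close>

lemma linear_block: "linear (block b i)"
  by (auto simp: linear_iff block_def vec_eq_iff)

lemma convex_block_product:
  assumes "\<And>i. convex (Xs i)"
  shows "convex (block_product b Xs)"
proof -
  have "block_product b Xs = (\<Inter>i. block b i -` Xs i)"
    by (auto simp: block_product_def)
  then show ?thesis
    by (simp add: convex_INT convex_linear_vimage[OF linear_block assms])
qed

lemma compact_block_product:
  fixes b :: "'n::finite \<Rightarrow> 'i"
  assumes "\<And>i. compact (Xs i)"
  shows "compact (block_product b Xs)"
proof -
  have "block_product b Xs = (\<Inter>i. block b i -` Xs i)"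
    by (auto simp: block_product_def)
  moreover have "closed (block b i -` Xs i)" for i
    by (rule closed_vimage[OF compact_imp_closed[OF assms]
          linear_continuous_on[OF linear_conv_bounded_linear[THEN iffD1, OF linear_block]]])
  ultimately have "closed (block_product b Xs)"
    by auto
  moreover have "bounded (block_product b Xs)"
  proof -
    obtain B where B: "\<And>i x. x \<in> Xs i \<Longrightarrow> norm x \<le> B i"
      using compact_imp_bounded[OF assms] unfolding bounded_iff by metis
    have "norm x \<le> (\<Sum>k\<in>UNIV. B (b k))" if x: "x \<in> block_product b Xs" for x
    proof -
      have "\<bar>x $ k\<bar> \<le> B (b k)" for k
      proof -
        have "\<bar>x $ k\<bar> = \<bar>block b (b k) x $ k\<bar>"
          by (simp add: block_def)
        also have "\<dots> \<le> B (b k)"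
          using component_le_norm_cart[of "block b (b k) x" k] B[of "block b (b k) x" "b k"] x
          by (simp add: block_product_def)
        finally show ?thesis .
      qed
      then show ?thesis
        by (intro order_trans[OF norm_le_l1_cart] sum_mono)
    qed
    then show ?thesis
      unfolding bounded_iff by blast
  qed
  ultimately show ?thesis
    by (simp add: compact_eq_bounded_closed)
qed

lemma convex_on_block_compose:
  assumes h: "convex_on (block_space b i) h"
  shows "convex_on UNIV (\<lambda>x. h (block b i x))"
proof (rule convex_onI)
  have mem: "block b i x \<in> block_space b i" for x
    by (simp add: block_def block_space_def)
  fix t :: real and x y
  assume "0 < t" "t < 1"
  then show "h (block b i ((1 - t) *\<^sub>R x + t *\<^sub>R y))
      \<le> (1 - t) * h (block b i x) + t * h (block b i y)"
    using convex_onD[OF h _ _ mem mem, of t x y]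
    by (simp add: linear_add[OF linear_block] linear_scale[OF linear_block])
qed simp

section \<open>Error of the regularized saddle point\<close>

theorem proposition1:
  fixes b :: "'n::finite \<Rightarrow> 'i::finite"
    and Xs :: "'i \<Rightarrow> (real ^ 'n) set" and X :: "(real ^ 'n) set"
    and c f :: "real ^ 'n \<Rightarrow> real" and fs :: "'i \<Rightarrow> real ^ 'n \<Rightarrow> real"
    and g :: "real ^ 'n \<Rightarrow> real ^ 'm::finite"
    and xbar xhat xhat_reg :: "real ^ 'n" and muhat_reg :: "real ^ 'm"
    and \<alpha> \<beta> \<epsilon> Mf M\<mu> Mx Mhat :: real and Mg :: "'m \<Rightarrow> real"
  assumes "\<And>i. Xs i \<subseteq> block_space b i"
    and "\<And>i. Xs i \<noteq> {}" and "\<And>i. compact (Xs i)" and "\<And>i. convex (Xs i)"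
    and "X = block_product b Xs"
    and "\<And>i. convex_on (block_space b i) (fs i)"
    and "\<And>i. C2 (\<lambda>x. fs i (block b i x))"
    and "convex_on UNIV c" and "C2 c"
    and "f = (\<lambda>x. c x + (\<Sum>i\<in>UNIV. fs i (block b i x)))"
    and "\<And>j. convex_on UNIV (\<lambda>x. g x $ j)" and "\<And>j. C2 (\<lambda>x. g x $ j)"
    and "xbar \<in> X" and "\<And>j. g xbar $ j < 0"
    and "is_arg_min f (\<lambda>x. x \<in> X \<and> (\<forall>j. g x $ j \<le> 0)) xhat"
    and "saddle_point (reg_lagrangian \<alpha> \<beta> f g) X nonneg_orthant xhat_reg muhat_reg"
    and "Mf = max_grad_norm X f"
    and "M\<mu> = max_norm (dual_set \<alpha> X f g xbar)"
    and "\<And>j. Mg j = max_grad_norm X (\<lambda>x. g x $ j)"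
    and "Mx = max_norm X"
    and "Mhat = max (MAX j. Mg j * M\<mu>) (Mf * M\<mu>)"
    and "\<epsilon> > 0" and "\<alpha> > 0" and "\<alpha> < 2 * \<epsilon> / (Mhat + Mx\<^sup>2)" and "\<beta> = \<alpha> ^ 3 / 2"
  shows "(\<forall>j. max 0 (g xhat_reg $ j) < \<epsilon>) \<and> \<bar>f xhat_reg - f xhat\<bar> < \<epsilon>"
proof -
  note Xs = assms(3,4) and X_eq = assms(5)
  note g_conv = assms(11) and g_C2 = assms(12) and slater = assms(13,14) and xhat = assms(15)
  note saddle = assms(16) and \<alpha> = assms(23)
  have X: "compact X" "convex X"
    using Xs by (auto simp: X_eq intro: compact_block_product convex_block_product)
  have f_conv: "convex_on UNIV f"
    unfolding assms(10)
    using assms(6,8) by (intro convex_on_add convex_on_sum_functions convex_on_block_compose) auto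
  have f_C2: "C2 f"
    unfolding assms(10) using assms(7,9) by (intro C2_add C2_sum)
  note f_conv = convex_on_subset[OF f_conv subset_UNIV X(2)]
  note g_conv = convex_on_subset[OF g_conv subset_UNIV X(2)]
  define h where "h = (\<lambda>x. f x + \<alpha> / 2 * (norm x)\<^sup>2)"
  have h_conv: "convex_on X h"
    unfolding h_def using X(2) \<alpha>
    by (intro convex_on_add f_conv convex_on_cmul convex_on_norm_sq) simp
  have feasible: "compact {x \<in> X. \<forall>j. g x $ j \<le> 0}"
  proof -
    have "{x \<in> X. \<forall>j. g x $ j \<le> 0} = X \<inter> (\<Inter>j. {x. g x $ j \<le> 0})"
      by auto
    then show ?thesis
      using C2_continuous[OF g_C2] X(1)
      by (auto intro!: compact_Int_closed closed_INT closed_Collect_le continuous_on_const)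
  qed
  have "continuous_on {x \<in> X. \<forall>j. g x $ j \<le> 0} h"
    unfolding h_def by (intro continuous_intros C2_continuous[OF f_C2])
  moreover have "{x \<in> X. \<forall>j. g x $ j \<le> 0} \<noteq> {}"
    using slater by (auto intro: less_imp_le)
  ultimately obtain y where y: "y \<in> X" "\<And>j. g y $ j \<le> 0"
    and y_min: "\<And>z. z \<in> X \<Longrightarrow> \<forall>j. g z $ j \<le> 0 \<Longrightarrow> h y \<le> h z"
    using continuous_attains_inf[OF feasible] by blast
  obtain \<kappa> where \<kappa>: "\<kappa> \<in> nonneg_orthant" and dual: "\<And>z. z \<in> X \<Longrightarrow> h y \<le> h z + \<kappa> \<bullet> g z"
    using slater_lagrange_multiplier[OF X(2) h_conv g_conv slater y_min] by blast
  have "\<kappa> \<in> dual_set \<alpha> X f g xbar"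
  proof -
    have "bdd_below (f ` X)"
      using compact_continuous_image[OF C2_continuous[OF f_C2] X(1)]
      by (simp add: bounded_imp_bdd_below compact_imp_bounded)
    then have "(INF x\<in>X. f x) \<le> f y"
      using y(1) by (rule cINF_lower)
    also have "\<dots> \<le> h y"
      using \<alpha> by (simp add: h_def)
    also have "\<dots> \<le> h xbar + \<kappa> \<bullet> g xbar"
      by (rule dual[OF slater(1)])
    finally show ?thesis
      using multiplier_l1_bound[OF \<kappa> slater(2)] \<kappa> by (simp add: dual_set_def h_def)
  qed
  then have \<kappa>_le: "norm \<kappa> \<le> M\<mu>"
    unfolding assms(18) by (rule norm_le_max_norm[OF bounded_dual_set])
  define d where "d = norm (xhat_reg - y)"
  have "0 \<le> \<beta>"
    unfolding assms(25) using \<alpha> by simp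
  then have "\<alpha> * d\<^sup>2 \<le> \<beta> / 4 * (norm \<kappa>)\<^sup>2"
    unfolding d_def
    by (rule regularized_saddle_distance[OF X(2) f_conv g_conv saddle _ y \<kappa> dual[unfolded h_def]])
  also have "\<dots> \<le> \<alpha> * (\<alpha> / 2 * norm \<kappa>)\<^sup>2"
  proof -
    have "\<beta> / 4 * (norm \<kappa>)\<^sup>2 = \<alpha> * (\<alpha> / 2 * norm \<kappa>)\<^sup>2 / 2"
      by (simp add: assms(25) power2_eq_square power3_eq_cube)
    moreover have "0 \<le> \<alpha> * (\<alpha> / 2 * norm \<kappa>)\<^sup>2"
      using \<alpha> by (intro mult_nonneg_nonneg zero_le_power2) simp
    ultimately show ?thesis
      by linarith
  qed
  finally have "d\<^sup>2 \<le> (\<alpha> / 2 * norm \<kappa>)\<^sup>2"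
    using \<alpha> by (simp only: mult_le_cancel_left_pos)
  then have "d \<le> \<alpha> / 2 * norm \<kappa>"
    by (rule power2_le_imp_le) (use \<alpha> in simp)
  also have "\<dots> \<le> \<alpha> / 2 * M\<mu>"
    using \<kappa>_le \<alpha> by simp
  finally have d: "d \<le> \<alpha> / 2 * M\<mu>" .
  have x: "xhat_reg \<in> X"
    using saddle by (simp add: saddle_point_def)
  have change: "\<bar>k xhat_reg - k y\<bar> \<le> \<alpha> / 2 * Mhat"
    if k: "C2 k" and le: "max_grad_norm X k * M\<mu> \<le> Mhat" for k
  proof -
    have "\<bar>k xhat_reg - k y\<bar> \<le> max_grad_norm X k * d"
      unfolding d_def using lipschitz_max_grad_norm[OF X k x y(1)] .
    also have "\<dots> \<le> max_grad_norm X k * (\<alpha> / 2 * M\<mu>)"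
      using d max_grad_norm_nonneg[OF X(1) k x] by (rule mult_left_mono)
    also have "\<dots> \<le> \<alpha> / 2 * Mhat"
      using le \<alpha> by simp
    finally show ?thesis .
  qed
  have f_change: "\<bar>f xhat_reg - f y\<bar> \<le> \<alpha> / 2 * Mhat"
    using f_C2 by (rule change) (simp add: assms(17,21))
  have "\<bar>g xhat_reg $ j - g y $ j\<bar> \<le> \<alpha> / 2 * Mhat" for j
  proof (rule change[OF g_C2])
    have "Mg j * M\<mu> \<le> (MAX j. Mg j * M\<mu>)"
      by (intro Max_ge) auto
    then show "max_grad_norm X (\<lambda>x. g x $ j) * M\<mu> \<le> Mhat"
      by (simp add: assms(19)[symmetric] assms(21) max.coboundedI1)
  qed
  then have g_le: "max 0 (g xhat_reg $ j) \<le> \<alpha> / 2 * Mhat" for j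
  proof -
    have "g xhat_reg $ j - g y $ j \<le> \<alpha> / 2 * Mhat"
      using \<open>\<bar>g xhat_reg $ j - g y $ j\<bar> \<le> \<alpha> / 2 * Mhat\<close> by linarith
    moreover have "0 \<le> \<alpha> / 2 * Mhat"
      using f_change by linarith
    ultimately show ?thesis
      using y(2)[of j] by simp
  qed
  have Mx: "\<alpha> / 2 * (norm z)\<^sup>2 \<le> \<alpha> / 2 * Mx\<^sup>2" if "z \<in> X" for z
    using \<alpha> norm_le_max_norm[OF compact_imp_bounded[OF X(1)] that] assms(20)
    by (simp add: power_mono)
  have xhat_min: "xhat \<in> X" "\<forall>j. g xhat $ j \<le> 0"
      "\<And>z. z \<in> X \<Longrightarrow> \<forall>j. g z $ j \<le> 0 \<Longrightarrow> f xhat \<le> f z"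
    using xhat unfolding is_arg_min_def by (auto simp: not_less)
  have "f xhat \<le> f y"
    using xhat_min(3) y by blast
  moreover have "f y \<le> f xhat + \<alpha> / 2 * Mx\<^sup>2"
  proof -
    have "f y \<le> h y"
      using \<alpha> by (simp add: h_def)
    also have "\<dots> \<le> h xhat"
      using y_min xhat_min(1,2) by blast
    also have "\<dots> \<le> f xhat + \<alpha> / 2 * Mx\<^sup>2"
      using Mx[OF xhat_min(1)] by (simp add: h_def)
    finally show ?thesis .
  qed
  ultimately have f_le: "\<bar>f xhat_reg - f xhat\<bar> \<le> \<alpha> / 2 * Mhat + \<alpha> / 2 * Mx\<^sup>2"
    using f_change by linarith
  have "0 \<le> Mhat"
    using order_trans[OF abs_ge_zero f_change] \<alpha> by (simp add: zero_le_mult_iff)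
  have small: "\<alpha> / 2 * Mhat + \<alpha> / 2 * Mx\<^sup>2 < \<epsilon>"
  proof -
    \<comment> \<open>Division by zero yields \<open>0\<close>, so a vanishing denominator would force \<open>\<alpha> < 0\<close>.\<close>
    have "Mhat + Mx\<^sup>2 \<noteq> 0"
      using assms(23,24) by auto
    then have "0 < Mhat + Mx\<^sup>2"
      using \<open>0 \<le> Mhat\<close> by (simp add: order_le_neq_trans)
    then show ?thesis
      using assms(24) by (simp add: field_simps)
  qed
  moreover have "0 \<le> \<alpha> / 2 * Mx\<^sup>2"
    using \<alpha> by simp
  ultimately have "max 0 (g xhat_reg $ j) < \<epsilon>" for j
    using g_le[of j] by linarith
  with small f_le show ?thesis
    by (auto intro: le_less_trans)
qed

end
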